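(* Assume the setting described in the context. For every $v\in\{0,\dots,\tau-1\}$, $$N_v=l^{\overline{E}_{v,\tau}}\,\mu_{v,\tau}-m^{F_{v,\tau}}\,\lambda_{v,\tau}.$$
   Context: Setting. Let $m,l\ge 2$ be coprime integers and $\tau\ge1$ an integer. Let $f_0,\dots,f_{\tau-1}$ be positive integers. Let $(a_{v,i})$, $v\in\{0,\dots,\tau-1\}$, $i\in\{0,\dots,l-1\}$, be integers with $a_{v,0}=0$ and, for $i\neq0$: $a_{v,i}\equiv -m^{f_v}i \pmod l$, $a_{v,i}\not\equiv0\pmod m$ and $a_{v,i}\not\equiv 0\pmod l$. For each $v\in\{0,\dots,\tau-1\}$ fix an admissible choice: an index $i_v\in\{1,\dots,l-1\}$, with $a_v:=a_{v,i_v}$; an integer $s_v$ with $1\le s_v\le m^{f_v}-1$ and $\gcd(s_v,m)=1$; and positive integers $e_v,r_v$ with $r_v\equiv i_v\pmod l$, $l^{e_v}s_v=m^{f_v}r_v+a_v$, and $|a_v|<\max(m^{f_v},l^{e_v})$. All indexed quantities are extended $\tau$-periodically to all integer indices. Sums. For $v\in\mathbb Z$, $u\ge0$: $F_{v,u}=\sum_{y=0}^{u-1}f_{v+y}$, $\overline{E}_{v,u}=\sum_{y=0}^{u-1}e_{v-1-y}$. Let $N_v=\sum_{w=0}^{\tau-1}m^{F_{v,w}}l^{\overline{E}_{v,\tau-1-w}}a_{v+w}$ and $D_v=l^{\overline{E}_{v,\tau}}-m^{F_{v,\tau}}$. Iterates. Let $\mathbb Z_{\langle m,l\rangle}$ be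 the subring of $\mathbb Q$ of fractions whose denominators are coprime to both $m$ and $l$. Let $(n_v)_{v\in\mathbb Z}$ be a $\tau$-periodic sequence in $\mathbb Z_{\langle m,l\rangle}$ with $n_v\equiv s_v\pmod{m^{f_v}}$ and $n_{v+1}=l^{e_v}\frac{n_v-s_v}{m^{f_v}}+r_v$ for all $v$. Graded digits. $k_{v,0}=n_v$, $k_{v,u}=m^{f_{v+u}}k_{v,u+1}+d_{v,u}$ with $d_{v,u}\in\{0,\dots,m^{f_{v+u}}-1\}$, $k_{v,u+1}\in\mathbb Z_{\langle m,l\rangle}$; $j_{v,0}=n_v$, $j_{v,u}=l^{e_{v-1-u}}j_{v,u+1}+b_{v,u}$ with $b_{v,u}\in\{0,\dots,l^{e_{v-1-u}}-1\}$, $j_{v,u+1}\in\mathbb Z_{\langle m,l\rangle}$. Residues. $\mu_{v,u}=\sum_{w=0}^{u-1}m^{F_{v,w}}d_{v,w}$ (the $\mathbf m$-residue of index $u$ of $n_v$) and $\lambda_{v,u}=\sum_{w=0}^{u-1}l^{\overline{E}_{v,w}}b_{v,w}$ (the $\mathbf l$-residue of index $u$ of $n_v$). *)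

theory Defs
  imports Complex_Main "HOL-Number_Theory.Cong"
begin

text \<open>The ring of fractions whose (reduced) denominator is coprime to both \<open>m\<close> and \<open>l\<close>.\<close>

definition Z_loc :: "int \<Rightarrow> int \<Rightarrow> rat set" where
  "Z_loc m l = {x. coprime (snd (quotient_of x)) m \<and> coprime (snd (quotient_of x)) l}"

text \<open>Congruence in that ring modulo the principal ideal generated by the integer \<open>q\<close>.\<close>

definition cong_loc :: "int \<Rightarrow> int \<Rightarrow> rat \<Rightarrow> rat \<Rightarrow> int \<Rightarrow> bool" where
  "cong_loc m l x y q \<longleftrightarrow> (\<exists>t\<in>Z_loc m l. x - y = of_int q * t)"

definition periodic :: "nat \<Rightarrow> (int \<Rightarrow> 'a) \<Rightarrow> bool" where
  "periodic \<tau> g \<longleftrightarrow> (\<forall>v. g (v + int \<tau>) = g v)"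

definition F_sum :: "(int \<Rightarrow> nat) \<Rightarrow> int \<Rightarrow> nat \<Rightarrow> nat" where
  "F_sum f v u = (\<Sum>y<u. f (v + int y))"

definition E_sum :: "(int \<Rightarrow> nat) \<Rightarrow> int \<Rightarrow> nat \<Rightarrow> nat" where
  "E_sum e v u = (\<Sum>y<u. e (v - 1 - int y))"

definition N_sum ::
  "int \<Rightarrow> int \<Rightarrow> nat \<Rightarrow> (int \<Rightarrow> nat) \<Rightarrow> (int \<Rightarrow> nat) \<Rightarrow> (int \<Rightarrow> int) \<Rightarrow> int \<Rightarrow> int" where
  "N_sum m l \<tau> f e a v =
     (\<Sum>w<\<tau>. m ^ F_sum f v w * l ^ E_sum e v (\<tau> - 1 - w) * a (v + int w))"

text \<open>Graded digit expansions: \<open>k\<close> and \<open>j\<close> are the successive quotients, \<open>d\<close> and \<open>b\<close> the digits.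
  Each residue class of the ring modulo a power of \<open>m\<close> (or \<open>l\<close>) contains exactly one integer
  in the stated digit range, so \<open>n\<close> determines \<open>k\<close>, \<open>d\<close>, \<open>j\<close>, \<open>b\<close>, and they exist
  whenever \<open>n\<close> takes values in the ring.\<close>

definition m_digits ::
  "int \<Rightarrow> int \<Rightarrow> (int \<Rightarrow> nat) \<Rightarrow> (int \<Rightarrow> rat) \<Rightarrow> (int \<Rightarrow> nat \<Rightarrow> rat) \<Rightarrow> (int \<Rightarrow> nat \<Rightarrow> int) \<Rightarrow> bool" where
  "m_digits m l f n k d \<longleftrightarrow>
     (\<forall>v. k v 0 = n v \<and>
       (\<forall>u. k v u = of_int (m ^ f (v + int u)) * k v (Suc u) + of_int (d v u) \<and>
            d v u \<in> {0..m ^ f (v + int u) - 1} \<and>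
            k v (Suc u) \<in> Z_loc m l))"

definition l_digits ::
  "int \<Rightarrow> int \<Rightarrow> (int \<Rightarrow> nat) \<Rightarrow> (int \<Rightarrow> rat) \<Rightarrow> (int \<Rightarrow> nat \<Rightarrow> rat) \<Rightarrow> (int \<Rightarrow> nat \<Rightarrow> int) \<Rightarrow> bool" where
  "l_digits m l e n j b \<longleftrightarrow>
     (\<forall>v. j v 0 = n v \<and>
       (\<forall>u. j v u = of_int (l ^ e (v - 1 - int u)) * j v (Suc u) + of_int (b v u) \<and>
            b v u \<in> {0..l ^ e (v - 1 - int u) - 1} \<and>
            j v (Suc u) \<in> Z_loc m l))"

definition m_residue :: "int \<Rightarrow> (int \<Rightarrow> nat) \<Rightarrow> (int \<Rightarrow> nat \<Rightarrow> int) \<Rightarrow> int \<Rightarrow> nat \<Rightarrow> int" where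
  "m_residue m f d v u = (\<Sum>w<u. m ^ F_sum f v w * d v w)"

definition l_residue :: "int \<Rightarrow> (int \<Rightarrow> nat) \<Rightarrow> (int \<Rightarrow> nat \<Rightarrow> int) \<Rightarrow> int \<Rightarrow> nat \<Rightarrow> int" where
  "l_residue l e b v u = (\<Sum>w<u. l ^ E_sum e v w * b v w)"

end

theory Submission
  imports Defs
begin

text \<open>Eliminating \<open>s\<close> and \<open>r\<close>, the recursion reads \<open>l^e\<^sub>v n\<^sub>v = m^f\<^sub>v n\<^sub>v\<^sub>+\<^sub>1 + a\<^sub>v\<close>, so by periodicity the sum
  \<open>N\<^sub>v\<close> telescopes to \<open>(l^E - m^F) n\<^sub>v\<close>, where \<open>E\<close> and \<open>F\<close> are the total exponents over a period.
  Since \<open>n\<^sub>v\<close> equals both \<open>\<mu> + m^F k\<close> and \<open>\<lambda> + l^E j\<close>, with \<open>k\<close> and \<open>j\<close> the final quotients of the two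
  expansions, it remains to show \<open>k = j\<close>.
  The point is a carry argument: \<open>k\<^sub>v\<^sub>+\<^sub>1\<^sub>,\<^sub>u = l^e\<^sub>v k\<^sub>v\<^sub>,\<^sub>u\<^sub>+\<^sub>1 + c\<close> with an integer carry \<open>0 \<le> c < l^e\<^sub>v\<close>.
  For \<open>u = 0\<close> the carry is \<open>r\<^sub>v\<close>, and the bounds survive each step in \<open>u\<close>. Hence the carries
  are the \<open>l\<close>-digits, and \<open>j\<^sub>v\<^sub>,\<^sub>u = k\<^sub>v\<^sub>-\<^sub>u\<^sub>,\<^sub>u\<close>, which at \<open>u = \<tau>\<close> is \<open>k\<^sub>v\<^sub>,\<^sub>\<tau>\<close>.\<close>

subsection \<open>Divisibility in the localisation\<close>

text \<open>Any denominator coprime to \<open>m\<close> and \<open>l\<close> witnesses membership,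
  since the reduced denominator divides it. This spares later arguments from handling
  \<open>quotient_of\<close>.\<close>

lemma Z_loc_iff:
  "x \<in> Z_loc m l \<longleftrightarrow> (\<exists>q. coprime q m \<and> coprime q l \<and> q \<noteq> 0 \<and> of_int q * x \<in> \<int>)"
proof -
  obtain p q where pq: "quotient_of x = (p, q)" by force
  have q: "q > 0" using pq by (rule quotient_of_denom_pos)
  have cop: "coprime p q" using pq by (rule quotient_of_coprime)
  have x: "x = of_int p / of_int q" using pq by (rule quotient_of_div)
  show ?thesis
  proof
    assume "x \<in> Z_loc m l"
    then have "coprime q m" "coprime q l" using pq by (auto simp: Z_loc_def)
    moreover have "of_int q * x \<in> \<int>" using q x by simp
    ultimately show "\<exists>q. coprime q m \<and> coprime q l \<and> q \<noteq> 0 \<and> of_int q * x \<in> \<int>"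
      using q by blast
  next
    assume "\<exists>q. coprime q m \<and> coprime q l \<and> q \<noteq> 0 \<and> of_int q * x \<in> \<int>"
    then obtain q' z where q': "coprime q' m" "coprime q' l" and z: "of_int q' * x = of_int z"
      by (auto elim: Ints_cases)
    have "of_int (q' * p) = (of_int (z * q) :: rat)" using z q x by (simp add: field_simps)
    then have "q' * p = z * q" by (simp only: of_int_eq_iff)
    then have "q dvd q' * p" by simp
    then have "q dvd q'" using cop by (simp add: coprime_commute coprime_dvd_mult_left_iff)
    then have "coprime q m" "coprime q l"
      using q' coprime_divisors[OF _ dvd_refl] by blast+
    then show "x \<in> Z_loc m l" using pq by (simp add: Z_loc_def)
  qed
qed

lemma Z_loc_diff:
  assumes "x \<in> Z_loc m l" "y \<in> Z_loc m l"
  shows "x - y \<in> Z_loc m l"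
proof -
  from assms obtain q q' where q: "coprime q m" "coprime q l" "q \<noteq> 0" "of_int q * x \<in> \<int>"
    and q': "coprime q' m" "coprime q' l" "q' \<noteq> 0" "of_int q' * y \<in> \<int>"
    unfolding Z_loc_iff by blast
  have "of_int (q * q') * (x - y) = of_int q' * (of_int q * x) - of_int q * (of_int q' * y)"
    by (simp add: algebra_simps)
  also have "\<dots> \<in> \<int>" using q(4) q'(4) by (metis Ints_diff Ints_mult Ints_of_int)
  finally have "of_int (q * q') * (x - y) \<in> \<int>" .
  moreover have "coprime (q * q') m" "coprime (q * q') l" "q * q' \<noteq> 0" using q q' by auto
  ultimately show ?thesis unfolding Z_loc_iff by blast
qed

lemma Z_loc_mult_of_int:
  assumes "x \<in> Z_loc m l"
  shows "of_int c * x \<in> Z_loc m l"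
proof -
  from assms obtain q where q: "coprime q m" "coprime q l" "q \<noteq> 0" "of_int q * x \<in> \<int>"
    unfolding Z_loc_iff by blast
  have "of_int q * (of_int c * x) = of_int c * (of_int q * x)" by simp
  also have "\<dots> \<in> \<int>" using q(4) by (metis Ints_mult Ints_of_int)
  finally show ?thesis unfolding Z_loc_iff using q by blast
qed

text \<open>A denominator \<open>q\<close> of \<open>x\<close> is coprime to \<open>t\<close>, so
  \<open>q * z = t * y\<close> forces \<open>t\<close> to divide \<open>z\<close>, and
  \<open>x = z / t\<close> is an integer.\<close>

lemma Z_loc_integral:
  assumes x: "x \<in> Z_loc m l" and t: "of_int t * x = of_int z"
    and t': "t dvd m ^ k \<or> t dvd l ^ k" "t \<noteq> 0"
  shows "x \<in> \<int>"
proof -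
  from x obtain q y where q: "coprime q m" "coprime q l" "q \<noteq> 0" and y: "of_int q * x = of_int y"
    unfolding Z_loc_iff by (auto elim: Ints_cases)
  have "coprime q t" using t'(1)
  proof
    assume "t dvd m ^ k"
    then show ?thesis using q(1) by (auto intro: coprime_divisors[OF dvd_refl])
  next
    assume "t dvd l ^ k"
    then show ?thesis using q(2) by (auto intro: coprime_divisors[OF dvd_refl])
  qed
  have "of_int (q * z) = (of_int (t * y) :: rat)"
    by (simp add: t[symmetric] y[symmetric])
  then have "q * z = t * y" by (simp only: of_int_eq_iff)
  then have "t dvd q * z" by simp
  then have "t dvd z" using \<open>coprime q t\<close> by (simp add: coprime_commute coprime_dvd_mult_right_iff)
  then obtain c where "z = t * c" by blast
  then have "x = of_int c" using t t'(2) by simp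
  then show ?thesis by simp
qed

text \<open>The difference of the quotients is integral by \<open>Z_loc_integral\<close>, so the
  remainders are congruent modulo \<open>q\<close>, and both lie in one complete residue
  system.\<close>

lemma Z_loc_division_unique:
  assumes "y \<in> Z_loc m l" "y' \<in> Z_loc m l"
    and eq: "of_int q * y + of_int c = of_int q * y' + of_int c'"
    and c: "c \<in> {0..q - 1}" "c' \<in> {0..q - 1}"
    and q: "q dvd m ^ k \<or> q dvd l ^ k"
  shows "y = y' \<and> c = c'"
proof -
  have q0: "q > 0" using c by auto
  have *: "of_int q * (y - y') = of_int (c' - c)" using eq by (simp add: algebra_simps)
  have "y - y' \<in> \<int>"
    by (rule Z_loc_integral[OF Z_loc_diff[OF assms(1,2)] * q]) (use q0 in simp)
  then obtain t where t: "y - y' = of_int t" by (auto elim: Ints_cases)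
  have "of_int (q * t) = (of_int (c' - c) :: rat)" using * t by simp
  then have "q * t = c' - c" by (simp only: of_int_eq_iff)
  then have "c mod q = c' mod q" by (metis mod_eq_dvd_iff dvd_triv_left)
  then have "c = c'" using c by simp
  then show ?thesis using * q0 by simp
qed

subsection \<open>Periodic sequences and exponent sums\<close>

text \<open>Serves to carry facts known on one period over to all integers.\<close>

lemma periodic_mod:
  assumes "periodic \<tau> g"
  shows "g (v mod int \<tau>) = g v"
proof -
  have nat: "g (w + int \<tau> * int c) = g w" for w c
  proof (induction c)
    case (Suc c)
    have "g (w + int \<tau> * int (Suc c)) = g ((w + int \<tau> * int c) + int \<tau>)"
      by (simp add: algebra_simps)
    then show ?case using assms Suc by (simp add: periodic_def)
  qed simp
  have v: "v = v mod int \<tau> + int \<tau> * (v div int \<tau>)" by simp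
  show ?thesis
  proof (cases "v div int \<tau> \<ge> 0")
    case True
    then show ?thesis using nat[of "v mod int \<tau>" "nat (v div int \<tau>)"] by simp
  next
    case False
    \<comment> \<open>For a negative quotient the walk goes the other way: whole periods are added
      to \<open>v\<close> until its residue is reached.\<close>
    then have "v + int \<tau> * int (nat (- (v div int \<tau>))) = v mod int \<tau>"
      using v by (simp add: algebra_simps)
    then show ?thesis using nat[of v "nat (- (v div int \<tau>))"] by simp
  qed
qed

lemma F_sum_Suc: "F_sum f v (Suc u) = F_sum f v u + f (v + int u)"
  by (simp add: F_sum_def)

lemma E_sum_Suc: "E_sum e v (Suc u) = E_sum e v u + e (v - 1 - int u)"
  by (simp add: E_sum_def)

lemma N_sum_telescope:
  fixes n :: "int \<Rightarrow> rat"
  assumes rec: "\<And>v. of_int (l ^ e v) * n v = of_int (m ^ f v) * n (v + 1) + of_int (a v)"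
    and e: "periodic \<tau> e" and n: "periodic \<tau> n"
  shows "of_int (N_sum m l \<tau> f e a v) =
    of_int (l ^ E_sum e v \<tau>) * n v - of_int (m ^ F_sum f v \<tau>) * n v"
proof -
  \<comment> \<open>Passing from \<open>w\<close> to \<open>w + 1\<close> trades one factor
    \<open>l ^ e (v + w)\<close> for one factor \<open>m ^ f (v + w)\<close>, which is exactly what
    \<open>rec\<close> measures.\<close>
  define T where "T w = of_int (m ^ F_sum f v w * l ^ E_sum e v (\<tau> - w)) * n (v + int w)" for w
  have step: "of_int (m ^ F_sum f v w * l ^ E_sum e v (\<tau> - 1 - w) * a (v + int w)) = T w - T (Suc w)"
    if "w < \<tau>" for w
  proof -
    obtain x where x: "\<tau> = Suc (w + x)" using \<open>w < \<tau>\<close> less_imp_Suc_add by blast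
    \<comment> \<open>\<open>E_sum\<close> runs backwards from \<open>v - 1\<close>; a shift by one
      period turns its last index into \<open>v + w\<close>, the index at which \<open>rec\<close>
      is applied.\<close>
    have "e (v - 1 - int x) = e (v - 1 - int x + int \<tau>)" using e by (simp add: periodic_def)
    also have "v - 1 - int x + int \<tau> = v + int w" using x by simp
    finally have E: "E_sum e v (Suc x) = E_sum e v x + e (v + int w)" by (simp add: E_sum_Suc)
    have a: "of_int (a (v + int w)) =
        of_int (l ^ e (v + int w)) * n (v + int w) - of_int (m ^ f (v + int w)) * n (v + int (Suc w))"
      using rec[of "v + int w"] by (simp add: algebra_simps)
    have "\<tau> - w = Suc x" "\<tau> - 1 - w = x" "\<tau> - Suc w = x" using x by auto
    then show ?thesis
      by (simp add: T_def E F_sum_Suc power_add a algebra_simps)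
  qed
  have "of_int (N_sum m l \<tau> f e a v) = (\<Sum>w<\<tau>. T w - T (Suc w))"
    unfolding N_sum_def of_int_sum by (intro sum.cong refl step) simp
  also have "\<dots> = T 0 - T \<tau>" by (rule sum_lessThan_telescope')
  finally show ?thesis using n by (simp add: T_def periodic_def F_sum_def E_sum_def)
qed

subsection \<open>Graded digit expansions\<close>

lemma m_digitsD:
  assumes "m_digits m l f n k d"
  shows "k v 0 = n v"
    and "k v u = of_int (m ^ f (v + int u)) * k v (Suc u) + of_int (d v u)"
    and "d v u \<in> {0..m ^ f (v + int u) - 1}"
    and "k v (Suc u) \<in> Z_loc m l"
  using assms unfolding m_digits_def by blast+

lemma l_digitsD:
  assumes "l_digits m l e n j b"
  shows "j v 0 = n v"
    and "j v u = of_int (l ^ e (v - 1 - int u)) * j v (Suc u) + of_int (b v u)"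
    and "b v u \<in> {0..l ^ e (v - 1 - int u) - 1}"
    and "j v (Suc u) \<in> Z_loc m l"
  using assms unfolding l_digits_def by blast+

lemma m_digits_residue:
  assumes "m_digits m l f n k d"
  shows "n v = of_int (m_residue m f d v u) + of_int (m ^ F_sum f v u) * k v u"
proof (induction u)
  case 0
  show ?case using m_digitsD(1)[OF assms] by (simp add: m_residue_def F_sum_def)
next
  case (Suc u)
  then show ?case using m_digitsD(2)[OF assms, of v u]
    by (simp add: m_residue_def F_sum_Suc power_add algebra_simps)
qed

lemma l_digits_residue:
  assumes "l_digits m l e n j b"
  shows "n v = of_int (l_residue l e b v u) + of_int (l ^ E_sum e v u) * j v u"
proof (induction u)
  case 0
  show ?case using l_digitsD(1)[OF assms] by (simp add: l_residue_def E_sum_def)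
next
  case (Suc u)
  then show ?case using l_digitsD(2)[OF assms, of v u]
    by (simp add: l_residue_def E_sum_Suc power_add algebra_simps)
qed

text \<open>Each quotient is determined by the preceding one and the modulus, by uniqueness of
  division, so the period of \<open>n\<close> and \<open>f\<close> is inherited.\<close>

lemma m_digits_periodic:
  assumes dig: "m_digits m l f n k d" and f: "periodic \<tau> f" and n: "periodic \<tau> n"
  shows "k (v + int \<tau>) u = k v u"
proof (induction u)
  case 0
  show ?case using n by (simp add: m_digitsD(1)[OF dig] periodic_def)
next
  case (Suc u)
  have "f (v + int \<tau> + int u) = f (v + int u + int \<tau>)" by (simp add: algebra_simps)
  then have f': "f (v + int \<tau> + int u) = f (v + int u)" using f by (simp add: periodic_def)
  show ?case
    using Z_loc_division_unique[OF m_digitsD(4)[OF dig, of "v + int \<tau>" u] m_digitsD(4)[OF dig, of v u],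
        of "m ^ f (v + int u)" "d (v + int \<tau>) u" "d v u" "f (v + int u)"]
      m_digitsD(2)[OF dig, of "v + int \<tau>" u] m_digitsD(2)[OF dig, of v u]
      m_digitsD(3)[OF dig, of "v + int \<tau>" u] m_digitsD(3)[OF dig, of v u] Suc f'
    by simp
qed

text \<open>One column of schoolbook multiplication by \<open>p\<close> in base \<open>q\<close>:
  the digit \<open>d\<close> and incoming carry \<open>c\<close> give
  \<open>p * d + c = q * c' + d'\<close>, with outgoing carry \<open>c'\<close>. Integrality of
  \<open>c'\<close> comes from \<open>Z_loc_integral\<close>.\<close>

lemma carry_step:
  fixes x x' :: rat and q p c d d' :: int
  assumes "x \<in> Z_loc m l" "x' \<in> Z_loc m l"
    and eq: "of_int q * x' + of_int d' = of_int p * (of_int q * x + of_int d) + of_int c"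
    and c: "c \<in> {0..p - 1}" and d: "d \<in> {0..q - 1}" "d' \<in> {0..q - 1}"
    and q: "q dvd m ^ k \<or> q dvd l ^ k"
  shows "\<exists>c'\<in>{0..p - 1}. x' = of_int p * x + of_int c'"
proof -
  have q0: "q > 0" and p0: "p > 0" using c d by auto
  have *: "of_int q * (x' - of_int p * x) = of_int (p * d + c - d')"
    using eq by (simp add: algebra_simps)
  have "x' - of_int p * x \<in> \<int>"
    by (rule Z_loc_integral[OF Z_loc_diff[OF assms(2) Z_loc_mult_of_int[OF assms(1)]] * q])
       (use q0 in simp)
  then obtain c' where c': "x' - of_int p * x = of_int c'" by (auto elim: Ints_cases)
  have "of_int (q * c') = (of_int (p * d + c - d') :: rat)" using * c' by simp
  then have qc: "q * c' = p * d + c - d'" by (simp only: of_int_eq_iff)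
  \<comment> \<open>Upper bound: \<open>p * d + c - d'\<close> is at most
    \<open>p * (q - 1) + (p - 1) = p * q - 1\<close>.\<close>
  have "p * d \<le> p * (q - 1)" using d p0 by (intro mult_left_mono) auto
  then have "p * d + p \<le> q * p" by (simp add: algebra_simps)
  moreover have "c \<le> p - 1" "0 \<le> d'" using c d by auto
  ultimately have "q * c' < q * p" using qc by linarith
  then have "c' < p" using q0 by simp
  \<comment> \<open>Lower bound: \<open>p * d + c - d'\<close> is at least \<open>- (q - 1)\<close>,
    so the integer \<open>c'\<close> exceeds \<open>- 1\<close>.\<close>
  have "0 \<le> p * d" using p0 d by simp
  moreover have "0 \<le> c" "d' \<le> q - 1" using c d by auto
  ultimately have "q * (- 1) < q * c'" using qc by linarith
  then have "- 1 < c'" using q0 by (simp only: mult_less_cancel_left_pos)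
  have "c' \<in> {0..p - 1}" using \<open>c' < p\<close> \<open>- 1 < c'\<close> by simp
  then show ?thesis using c' by (intro bexI[of _ c']) (simp_all add: algebra_simps)
qed

lemma m_digits_carry:
  assumes dig: "m_digits m l f n k d"
    and rec: "\<And>v. n (v + 1) = of_int (l ^ e v) * k v 1 + of_int (r v)"
    and r: "\<And>v. r v \<in> {0..l ^ e v - 1}"
  shows "\<exists>c\<in>{0..l ^ e v - 1}. k (v + 1) u = of_int (l ^ e v) * k v (Suc u) + of_int c"
proof (induction u)
  case 0
  show ?case using rec r by (intro bexI[of _ "r v"]) (simp_all add: m_digitsD(1)[OF dig])
next
  case (Suc u)
  then obtain c where c: "c \<in> {0..l ^ e v - 1}"
    and eq: "k (v + 1) u = of_int (l ^ e v) * k v (Suc u) + of_int c" by blast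
  \<comment> \<open>Digit \<open>u + 1\<close> of \<open>n v\<close> and digit \<open>u\<close> of
    \<open>n (v + 1)\<close> have the same modulus, as \<open>carry_step\<close> requires.\<close>
  have idx: "v + int (Suc u) = v + 1 + int u" by simp
  show ?case
    by (rule carry_step[OF m_digitsD(4)[OF dig] m_digitsD(4)[OF dig] _ c
          m_digitsD(3)[OF dig, of v "Suc u", unfolded idx] m_digitsD(3)[OF dig] disjI1[OF dvd_refl]])
       (use eq m_digitsD(2)[OF dig, of v "Suc u", unfolded idx] m_digitsD(2)[OF dig, of "v + 1" u]
         in simp)
qed

text \<open>Along the diagonal \<open>k (v - u) u\<close>, the carry identity is itself a division
  by \<open>l ^ e (v - 1 - u)\<close> with remainder in the digit range, hence the step that defines
  \<open>j\<close>.\<close>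

lemma l_digits_eq_m_digits:
  assumes mdig: "m_digits m l f n k d" and ldig: "l_digits m l e n j b"
    and carry: "\<And>v u. \<exists>c\<in>{0..l ^ e v - 1}.
      k (v + 1) u = of_int (l ^ e v) * k v (Suc u) + of_int c"
  shows "j v u = k (v - int u) u"
proof (induction u)
  case 0
  show ?case by (simp add: m_digitsD(1)[OF mdig] l_digitsD(1)[OF ldig])
next
  case (Suc u)
  have idx: "v - 1 - int u = v - int (Suc u)" "v - int (Suc u) + 1 = v - int u" by auto
  obtain c where c: "c \<in> {0..l ^ e (v - int (Suc u)) - 1}"
    and eq: "k (v - int u) u =
      of_int (l ^ e (v - int (Suc u))) * k (v - int (Suc u)) (Suc u) + of_int c"
    using carry[of "v - int (Suc u)" u] unfolding idx by blast
  have "of_int (l ^ e (v - int (Suc u))) * j v (Suc u) + of_int (b v u) =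
      of_int (l ^ e (v - int (Suc u))) * k (v - int (Suc u)) (Suc u) + of_int c"
    using l_digitsD(2)[OF ldig, of v u] eq Suc unfolding idx by simp
  from Z_loc_division_unique[OF l_digitsD(4)[OF ldig] m_digitsD(4)[OF mdig] this
      l_digitsD(3)[OF ldig, of v u, unfolded idx] c disjI2[OF dvd_refl]]
  show ?case by simp
qed

subsection \<open>Admissible choices\<close>

text \<open>Makes \<open>r\<close> a legitimate first carry, with \<open>p\<close> a power of
  \<open>m\<close> and \<open>q\<close> a power of \<open>l\<close>. Equality \<open>r = q\<close>
  would make \<open>l\<close> divide \<open>i\<close>; \<open>r > q\<close> would give
  \<open>- a \<ge> p + q\<close>, against the bound on \<open>a\<close>.\<close>

lemma admissible_remainder_less:
  fixes p q s r a i l :: int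
  assumes p: "p > 0" and q: "q > 0" "l dvd q" and s: "s \<le> p - 1" and i: "i \<in> {1..l - 1}"
    and ri: "[r = i] (mod l)" and eq: "q * s = p * r + a" and a: "\<bar>a\<bar> < max p q"
  shows "r < q"
proof (rule ccontr)
  assume "\<not> r < q"
  have "r \<noteq> q"
  proof
    assume "r = q"
    then have "[i = 0] (mod l)" using ri q by (metis cong_0_iff cong_sym cong_trans)
    then show False using i by (auto simp: cong_0_iff dest: zdvd_imp_le)
  qed
  then have "q + 1 \<le> r" using \<open>\<not> r < q\<close> by simp
  then have "p * (q + 1) \<le> p * r" using p by (intro mult_left_mono) auto
  moreover have "q * s \<le> q * (p - 1)" using q s by (intro mult_left_mono) auto
  ultimately have "p + q \<le> - a" using eq by (simp add: algebra_simps)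
  then show False using a p q by simp
qed

theorem theorem4p9:
  fixes m l :: int and \<tau> :: nat
    and f e :: "int \<Rightarrow> nat"
    and a :: "int \<Rightarrow> int \<Rightarrow> int"
    and i s r :: "int \<Rightarrow> int"
    and n :: "int \<Rightarrow> rat"
    and k j :: "int \<Rightarrow> nat \<Rightarrow> rat"
    and d b :: "int \<Rightarrow> nat \<Rightarrow> int"
  assumes "m \<ge> 2" and "l \<ge> 2" and "coprime m l" and "\<tau> \<ge> 1"
    and "periodic \<tau> f" and "periodic \<tau> e" and "periodic \<tau> i"
    and "periodic \<tau> s" and "periodic \<tau> r"
    and "\<And>h. h \<in> {0..l - 1} \<Longrightarrow> periodic \<tau> (\<lambda>v. a v h)"
    and "\<And>v. v \<in> {0..int \<tau> - 1} \<Longrightarrow> f v > 0"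
    and "\<And>v. v \<in> {0..int \<tau> - 1} \<Longrightarrow> a v 0 = 0"
    and "\<And>v h. v \<in> {0..int \<tau> - 1} \<Longrightarrow> h \<in> {1..l - 1} \<Longrightarrow>
           [a v h = - (m ^ f v * h)] (mod l) \<and>
           \<not> [a v h = 0] (mod m) \<and> \<not> [a v h = 0] (mod l)"
    and "\<And>v. v \<in> {0..int \<tau> - 1} \<Longrightarrow> i v \<in> {1..l - 1}"
    and "\<And>v. v \<in> {0..int \<tau> - 1} \<Longrightarrow> 1 \<le> s v \<and> s v \<le> m ^ f v - 1 \<and> gcd (s v) m = 1"
    and "\<And>v. v \<in> {0..int \<tau> - 1} \<Longrightarrow>
           e v > 0 \<and> r v > 0 \<and> [r v = i v] (mod l) \<and>
           l ^ e v * s v = m ^ f v * r v + a v (i v) \<and>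
           \<bar>a v (i v)\<bar> < max (m ^ f v) (l ^ e v)"
    and "periodic \<tau> n"
    and "\<And>v. n v \<in> Z_loc m l"
    and "\<And>v. cong_loc m l (n v) (of_int (s v)) (m ^ f v)"
    and "\<And>v. n (v + 1) =
           of_int (l ^ e v) * ((n v - of_int (s v)) / of_int (m ^ f v)) + of_int (r v)"
    and "m_digits m l f n k d"
    and "l_digits m l e n j b"
  shows "\<forall>v\<in>{0..int \<tau> - 1}.
           N_sum m l \<tau> f e (\<lambda>v. a v (i v)) v =
             l ^ E_sum e v \<tau> * m_residue m f d v \<tau> - m ^ F_sum f v \<tau> * l_residue l e b v \<tau>"
proof
  fix v assume "v \<in> {0..int \<tau> - 1}"
  note m = assms(1) and l = assms(2) and f_per = assms(5) and e_per = assms(6)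
    and n_per = assms(17) and n_cong = assms(19) and n_rec = assms(20)
    and mdig = assms(21) and ldig = assms(22)
  have adm: "1 \<le> s w \<and> s w \<le> m ^ f w - 1 \<and> 0 < r w \<and> r w < l ^ e w \<and>
      l ^ e w * s w = m ^ f w * r w + a w (i w)" for w
  proof -
    define w' where "w' = w mod int \<tau>"
    have w': "w' \<in> {0..int \<tau> - 1}" using assms(4) by (simp add: w'_def)
    have per: "f w' = f w" "e w' = e w" "i w' = i w" "s w' = s w" "r w' = r w"
      unfolding w'_def using assms(5-9) by (simp_all add: periodic_mod)
    \<comment> \<open>Periodicity of \<open>a\<close> is given for each fixed second argument in
      \<open>{0..l - 1}\<close>, so the range of \<open>i w\<close> comes first.\<close>
    have i: "i w \<in> {1..l - 1}" using assms(14)[OF w'] per by simp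
    then have "periodic \<tau> (\<lambda>v. a v (i w))" by (intro assms(10)) auto
    then have a: "a w' (i w) = a w (i w)" unfolding w'_def by (rule periodic_mod)
    have s: "1 \<le> s w" "s w \<le> m ^ f w - 1" using assms(15)[OF w'] per by auto
    have e: "e w > 0" "r w > 0" "[r w = i w] (mod l)"
      "l ^ e w * s w = m ^ f w * r w + a w (i w)" "\<bar>a w (i w)\<bar> < max (m ^ f w) (l ^ e w)"
      using assms(16)[OF w'] per a by auto
    have "r w < l ^ e w"
      by (rule admissible_remainder_less[OF _ _ _ s(2) i e(3,4,5)]) (use m l e(1) in auto)
    then show ?thesis using s e by blast
  qed
  have rec: "of_int (l ^ e w) * n w = of_int (m ^ f w) * n (w + 1) + of_int (a w (i w))" for w
  proof -
    have "of_int (l ^ e w * s w) = (of_int (m ^ f w * r w + a w (i w)) :: rat)" using adm[of w] by simp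
    then show ?thesis using n_rec[of w] m by (simp add: field_simps)
  qed
  have k1: "n (w + 1) = of_int (l ^ e w) * k w 1 + of_int (r w)" for w
  proof -
    \<comment> \<open>The congruence and the range of \<open>s w\<close> identify \<open>s w\<close>
      as the first \<open>m\<close>-digit of \<open>n w\<close>, with quotient
      \<open>t\<close>.\<close>
    obtain t where t: "t \<in> Z_loc m l" "n w - of_int (s w) = of_int (m ^ f w) * t"
      using n_cong[of w] unfolding cong_loc_def by blast
    have "of_int (m ^ f w) * k w (Suc 0) + of_int (d w 0) = of_int (m ^ f w) * t + of_int (s w)"
      using m_digitsD(1)[OF mdig, of w] m_digitsD(2)[OF mdig, of w 0] t(2) by (simp add: algebra_simps)
    moreover have "d w 0 \<in> {0..m ^ f w - 1}" using m_digitsD(3)[OF mdig, of w 0] by simp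
    moreover have "s w \<in> {0..m ^ f w - 1}" using adm[of w] by simp
    ultimately have "k w (Suc 0) = t"
      using Z_loc_division_unique[OF m_digitsD(4)[OF mdig] t(1) _ _ _ disjI1[OF dvd_refl]] by blast
    then show ?thesis using n_rec[of w] t(2) m by simp
  qed
  have "r w \<in> {0..l ^ e w - 1}" for w using adm[of w] by simp
  note carry = m_digits_carry[OF mdig, of e r, OF k1 this]
  have "j v \<tau> = k (v - int \<tau>) \<tau>" by (rule l_digits_eq_m_digits[OF mdig ldig carry])
  also have "\<dots> = k v \<tau>" using m_digits_periodic[OF mdig f_per n_per, of "v - int \<tau>"] by simp
  finally have jk: "j v \<tau> = k v \<tau>" .
  define M L where "M = m ^ F_sum f v \<tau>" and "L = l ^ E_sum e v \<tau>"
  have "of_int (N_sum m l \<tau> f e (\<lambda>v. a v (i v)) v) = of_int L * n v - of_int M * n v"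
    unfolding M_def L_def by (rule N_sum_telescope[OF rec e_per n_per])
  \<comment> \<open>The two copies of \<open>n v\<close> are expanded differently, by
    \<open>m\<close> here and by \<open>l\<close> next; both leave the term
    \<open>L * M * k v \<tau>\<close>, which cancels.\<close>
  also have "of_int L * n v = of_int L * (of_int (m_residue m f d v \<tau>) + of_int M * k v \<tau>)"
    unfolding M_def by (subst m_digits_residue[OF mdig, of v \<tau>]) simp
  also have "of_int M * n v = of_int M * (of_int (l_residue l e b v \<tau>) + of_int L * k v \<tau>)"
    unfolding L_def jk[symmetric] by (subst l_digits_residue[OF ldig, of v \<tau>]) simp
  finally have "of_int (N_sum m l \<tau> f e (\<lambda>v. a v (i v)) v) =
      (of_int (L * m_residue m f d v \<tau> - M * l_residue l e b v \<tau>) :: rat)"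
    by (simp add: algebra_simps)
  then show "N_sum m l \<tau> f e (\<lambda>v. a v (i v)) v =
      l ^ E_sum e v \<tau> * m_residue m f d v \<tau> - m ^ F_sum f v \<tau> * l_residue l e b v \<tau>"
    unfolding M_def L_def by (simp only: of_int_eq_iff)
qed

end
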